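(* Let $d\geq 4$, and assume $\operatorname{char}\mathcal K\neq 2$ if $d$ is odd. Every matrix $\mathcal A\in \mathrm{U}(d,\mathcal K)$ can be transformed, using elementary operations (multiplication on the left or right by elementary matrices), to a diagonal matrix of the form described below, and hence can be written as a product of elementary matrices and a diagonal matrix; that is, there are finitely many elementary matrices $x_1,\dots,x_r,y_1,\dots,y_n$ of $\mathrm{U}(d,\mathcal K)$ and a diagonal matrix $\Delta$ with $\mathcal A=x_1\cdots x_r\,\Delta\,y_1\cdots y_n$, where: (i) if $d=2l$, then $\Delta=\operatorname{diag}(1,\dots,1,\lambda,1,\dots,1,\bar\lambda^{-1})$ with $\lambda\in\mathcal K^\times$ in position $l$ and $\bar\lambda^{-1}$ in position $-l$, and $\lambda\bar\lambda^{-1}=\det\mathcal A$; (ii) if $d=2l+1$, then $\Delta=\operatorname{diag}(\alpha,1,\dots,1,\lambda,1,\dots,1,\bar\lambda^{-1})$ with $\alpha\in\mathcal K$ in position $0$, $\lambda\in\mathcal K^\times$ in position $l$ and $\bar\lambda^{-1}$ in position $-l$, and $\alpha\bar\alpha=1$, $\alpha\lambda\bar\lambda^{-1}=\det\mathcal A$.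
   Context: $\mathcal K$ is a field with a field automorphism $\sigma:x\mapsto\bar x$ of order $2$ with fixed field $k$ (so $\mathcal K/k$ is a quadratic extension). $\mathcal K^o=\{x\in\mathcal K\mid \bar x=-x\}$. For a matrix $X$, $\bar X$ denotes entrywise application of $\sigma$ and ${}^TX$ the transpose. Rows and columns are indexed by $1,\dots,l,-1,\dots,-l$ (in this order) if $d=2l$, and by $0,1,\dots,l,-1,\dots,-l$ (in this order) if $d=2l+1$, with $l\ge 2$. Set $\beta=\begin{pmatrix} 0 & I_l \\ I_l & 0 \end{pmatrix}$ if $d=2l$ and $\beta=\begin{pmatrix} 2 & 0 & 0 \\ 0 & 0 & I_l \\ 0 & I_l & 0 \end{pmatrix}$ if $d=2l+1$. The (split) unitary group is $\mathrm{U}(d,\mathcal K)=\{X\in \mathrm{GL}(d,\mathcal K)\mid {}^T\bar X\beta X=\beta\}$. Let $e_{a,b}$ be the matrix unit with $1$ in position $(a,b)$ and $0$ elsewhere. For $1\le i,j\le l$, $t\in\mathcal K$, $s\in\mathcal K^o$, the elementary matrices of $\mathrm{U}(2l,\mathcal K)$ are $x_{i,j}(t)=I+te_{i,j}-\bar t e_{-j,-i}$ ($i\ne j$); $x_{i,-j}(t)=I+te_{i,-j}-\bar t e_{j,-i}$ ($i<j$); $x_{-i,j}(t)=I+te_{-i,j}-\bar t e_{-j,i}$ ($i<j$); $x_{i,-i}(s)=I+se_{i,-i}$; $x_{-i,i}(s)=I+se_{-i,i}$. The elementary matrices of $\mathrm{U}(2l+1,\mathcal K)$ are those given by the same formulas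 (as matrices of size $2l+1$) together with $x_{i,0}(t)=I-2\bar t e_{i,0}+te_{0,-i}-t\bar t e_{i,-i}$ and $x_{0,i}(t)=I+te_{0,i}-2\bar t e_{-i,0}-t\bar t e_{-i,i}$. *)

theory Defs
  imports
    "Jordan_Normal_Form.Determinant"
    "HOL-Computational_Algebra.Computational_Algebra"
begin

definition order2_field_automorphism :: "('a::field \<Rightarrow> 'a) \<Rightarrow> bool" where
  "order2_field_automorphism \<sigma> \<longleftrightarrow> field_isom \<sigma> \<and> \<sigma> \<circ> \<sigma> = id \<and> \<sigma> \<noteq> id"

definition skew_elements :: "('a::field \<Rightarrow> 'a) \<Rightarrow> 'a set" where
  "skew_elements \<sigma> = {x. \<sigma> x = - x}"

text \<open>
  Rows and columns carry the labels \<open>1,\<dots>,l,-1,\<dots>,-l\<close> if \<open>d = 2l\<close> and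
  \<open>0,1,\<dots>,l,-1,\<dots>,-l\<close> if \<open>d = 2l+1\<close>, in this order. The function below sends a label to its
  zero-based position. For even \<open>d\<close> the label \<open>0\<close> does not exist, and it is never used.
\<close>

definition label_pos :: "nat \<Rightarrow> int \<Rightarrow> nat" where
  "label_pos d a =
     (let l = int (d div 2); p = (if a \<ge> 0 then a else l - a)
      in nat (if even d then p - 1 else p))"

definition unit_mat :: "nat \<Rightarrow> int \<Rightarrow> int \<Rightarrow> 'a::field mat" where
  "unit_mat d a b = mat d d (\<lambda>(r, c). if r = label_pos d a \<and> c = label_pos d b then 1 else 0)"

definition hyperbolic_mat :: "nat \<Rightarrow> 'a::field mat" where
  "hyperbolic_mat l = four_block_mat (0\<^sub>m l l) (1\<^sub>m l) (1\<^sub>m l) (0\<^sub>m l l)"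

definition form_mat :: "nat \<Rightarrow> 'a::field mat" where
  "form_mat d =
     (let l = d div 2 in
      if even d then hyperbolic_mat l
      else four_block_mat (mat 1 1 (\<lambda>_. 2)) (0\<^sub>m 1 (2 * l)) (0\<^sub>m (2 * l) 1) (hyperbolic_mat l))"

definition unitary_group :: "('a::field \<Rightarrow> 'a) \<Rightarrow> nat \<Rightarrow> 'a mat set" where
  "unitary_group \<sigma> d =
     {X \<in> carrier_mat d d. invertible_mat X \<and>
        transpose_mat (map_mat \<sigma> X) * form_mat d * X = form_mat d}"

inductive_set elementary_matrices :: "('a::field \<Rightarrow> 'a) \<Rightarrow> nat \<Rightarrow> 'a mat set"
  for \<sigma> :: "'a \<Rightarrow> 'a" and d :: nat where
  pos_pos: "i \<in> {1..int (d div 2)} \<Longrightarrow> j \<in> {1..int (d div 2)} \<Longrightarrow> i \<noteq> j \<Longrightarrow>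
     1\<^sub>m d + t \<cdot>\<^sub>m unit_mat d i j - \<sigma> t \<cdot>\<^sub>m unit_mat d (-j) (-i) \<in> elementary_matrices \<sigma> d"
| pos_neg: "i \<in> {1..int (d div 2)} \<Longrightarrow> j \<in> {1..int (d div 2)} \<Longrightarrow> i < j \<Longrightarrow>
     1\<^sub>m d + t \<cdot>\<^sub>m unit_mat d i (-j) - \<sigma> t \<cdot>\<^sub>m unit_mat d j (-i) \<in> elementary_matrices \<sigma> d"
| neg_pos: "i \<in> {1..int (d div 2)} \<Longrightarrow> j \<in> {1..int (d div 2)} \<Longrightarrow> i < j \<Longrightarrow>
     1\<^sub>m d + t \<cdot>\<^sub>m unit_mat d (-i) j - \<sigma> t \<cdot>\<^sub>m unit_mat d (-j) i \<in> elementary_matrices \<sigma> d"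
| long_pos: "i \<in> {1..int (d div 2)} \<Longrightarrow> s \<in> skew_elements \<sigma> \<Longrightarrow>
     1\<^sub>m d + s \<cdot>\<^sub>m unit_mat d i (-i) \<in> elementary_matrices \<sigma> d"
| long_neg: "i \<in> {1..int (d div 2)} \<Longrightarrow> s \<in> skew_elements \<sigma> \<Longrightarrow>
     1\<^sub>m d + s \<cdot>\<^sub>m unit_mat d (-i) i \<in> elementary_matrices \<sigma> d"
| pos_zero: "odd d \<Longrightarrow> i \<in> {1..int (d div 2)} \<Longrightarrow>
     1\<^sub>m d - (2 * \<sigma> t) \<cdot>\<^sub>m unit_mat d i 0 + t \<cdot>\<^sub>m unit_mat d 0 (-i)
       - (t * \<sigma> t) \<cdot>\<^sub>m unit_mat d i (-i) \<in> elementary_matrices \<sigma> d"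
| zero_pos: "odd d \<Longrightarrow> i \<in> {1..int (d div 2)} \<Longrightarrow>
     1\<^sub>m d + t \<cdot>\<^sub>m unit_mat d 0 i - (2 * \<sigma> t) \<cdot>\<^sub>m unit_mat d (-i) 0
       - (t * \<sigma> t) \<cdot>\<^sub>m unit_mat d (-i) i \<in> elementary_matrices \<sigma> d"

inductive elementary_transforms :: "('a::field \<Rightarrow> 'a) \<Rightarrow> nat \<Rightarrow> 'a mat \<Rightarrow> 'a mat \<Rightarrow> bool"
  for \<sigma> :: "'a \<Rightarrow> 'a" and d :: nat and A :: "'a mat" where
  refl: "elementary_transforms \<sigma> d A A"
| left: "elementary_transforms \<sigma> d A B \<Longrightarrow> X \<in> elementary_matrices \<sigma> d \<Longrightarrow>
     elementary_transforms \<sigma> d A (X * B)"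
| right: "elementary_transforms \<sigma> d A B \<Longrightarrow> X \<in> elementary_matrices \<sigma> d \<Longrightarrow>
     elementary_transforms \<sigma> d A (B * X)"

definition mat_list_prod :: "nat \<Rightarrow> 'a::field mat list \<Rightarrow> 'a mat" where
  "mat_list_prod d Xs = foldr (*) Xs (1\<^sub>m d)"

definition normal_diag_even :: "('a::field \<Rightarrow> 'a) \<Rightarrow> nat \<Rightarrow> 'a \<Rightarrow> 'a mat" where
  "normal_diag_even \<sigma> l \<mu> =
     (let d = 2 * l in
      mat_diag d (\<lambda>p. if p = label_pos d (int l) then \<mu>
                      else if p = label_pos d (- int l) then inverse (\<sigma> \<mu>)
                      else 1))"

definition normal_diag_odd :: "('a::field \<Rightarrow> 'a) \<Rightarrow> nat \<Rightarrow> 'a \<Rightarrow> 'a \<Rightarrow> 'a mat" where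
  "normal_diag_odd \<sigma> l \<alpha> \<mu> =
     (let d = 2 * l + 1 in
      mat_diag d (\<lambda>p. if p = label_pos d 0 then \<alpha>
                      else if p = label_pos d (int l) then \<mu>
                      else if p = label_pos d (- int l) then inverse (\<sigma> \<mu>)
                      else 1))"

end

theory Submission
  imports Defs
begin

text \<open>
  Only row operations are needed. Any nonzero isotropic column has a nonzero entry at a nonzero label,
  so for \<open>i < l\<close> operations with labels of absolute value at least \<open>i\<close> turn the entry at \<open>i\<close> into 1, while
  for \<open>i = l\<close> they at least make it nonzero. Once the entries outside \<open>i, -i\<close> are cleared, isotropy says that
  the quotient of the entries at \<open>-i\<close> and \<open>i\<close> is skew, so a long root operation clears
  the entry at \<open>-i\<close>. Column \<open>-i\<close> then has entry 1 (or \<open>\<sigma> \<mu>\<close> inverted) at \<open>-i\<close> and is cleared in the same way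
  without disturbing column \<open>i\<close>. Columns already finished stay unchanged, because orthogonality makes the
  corresponding rows trivial as well. Column \<open>0\<close> needs no operation: it is orthogonal to all others.

  Columns are treated as functions on signed labels, which makes one formula cover all four kinds of
  short root elements \<open>x\<^sub>\<plusminus>\<^sub>i\<^sub>,\<^sub>\<plusminus>\<^sub>j(t)\<close>, and both kinds of each of the others.
\<close>

section \<open>The Hermitian form and the root operations on functions of signed labels\<close>

definition point :: "int \<Rightarrow> 'a::zero \<Rightarrow> int \<Rightarrow> 'a" where
  "point a x = (\<lambda>r. if r = a then x else 0)"

text \<open>\<open>L\<close> stands for the set of labels. \<open>ex_skew\<close> supplies the
  parameter for the last pivot step, and \<open>two_neq_0\<close> is the condition on the
  characteristic, imposed only when the label 0 occurs.\<close>

locale unitary_form = field_isom \<sigma> for \<sigma> :: "'a::field \<Rightarrow> 'a" +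
  fixes L :: "int set"
  assumes finite_labels: "finite L"
    and uminus_label: "r \<in> L \<Longrightarrow> - r \<in> L"
    and invol [simp]: "\<sigma> (\<sigma> x) = x"
    and ex_skew: "\<exists>s. s \<noteq> 0 \<and> \<sigma> s = - s"
    and two_neq_0: "0 \<in> L \<Longrightarrow> (2 :: 'a) \<noteq> 0"
begin

lemmas hom_simps = hom_add hom_mult hom_minus hom_uminus hom_div

text \<open>The value at 0 is the corner entry 2 of \<open>form_mat\<close>.\<close>

definition weight :: "int \<Rightarrow> 'a" where
  "weight r = (if r = 0 then 2 else 1)"

text \<open>The sesquilinear form with matrix \<open>form_mat\<close>, whose nonzero entries pair
  \<open>r\<close> with \<open>- r\<close>.\<close>

definition form :: "(int \<Rightarrow> 'a) \<Rightarrow> (int \<Rightarrow> 'a) \<Rightarrow> 'a" where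
  "form v w = (\<Sum>r\<in>L. weight r * \<sigma> (v r) * w (- r))"

text \<open>The effect on a column of left multiplication by \<open>x_{a,b}(t)\<close>, for all
  signs of \<open>a\<close> and \<open>b\<close>.\<close>

definition short_op :: "int \<Rightarrow> int \<Rightarrow> 'a \<Rightarrow> (int \<Rightarrow> 'a) \<Rightarrow> int \<Rightarrow> 'a" where
  "short_op a b t v = (\<lambda>r. v r + point a (t * v b) r + point (- b) (- \<sigma> t * v (- a)) r)"

text \<open>Left multiplication by \<open>x_{-a,a}(s)\<close>, for either sign of
  \<open>a\<close>.\<close>

definition long_op :: "int \<Rightarrow> 'a \<Rightarrow> (int \<Rightarrow> 'a) \<Rightarrow> int \<Rightarrow> 'a" where
  "long_op a s v = (\<lambda>r. v r + point (- a) (s * v a) r)"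

text \<open>Left multiplication by \<open>x_{0,a}(t)\<close> if \<open>a > 0\<close> and by
  \<open>x_{-a,0}(t)\<close> if \<open>a < 0\<close>.\<close>

definition zero_op :: "int \<Rightarrow> 'a \<Rightarrow> (int \<Rightarrow> 'a) \<Rightarrow> int \<Rightarrow> 'a" where
  "zero_op a t v = (\<lambda>r. v r + point 0 (t * v a) r
     + point (- a) (- (2 * \<sigma> t) * v 0 - t * \<sigma> t * v a) r)"

inductive_set ops :: "((int \<Rightarrow> 'a) \<Rightarrow> int \<Rightarrow> 'a) set" where
  short: "a \<in> L \<Longrightarrow> b \<in> L \<Longrightarrow> a \<noteq> 0 \<Longrightarrow> b \<noteq> 0 \<Longrightarrow> a \<noteq> b \<Longrightarrow> a \<noteq> - b \<Longrightarrow> short_op a b t \<in> ops"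
| long: "a \<in> L \<Longrightarrow> a \<noteq> 0 \<Longrightarrow> \<sigma> s = - s \<Longrightarrow> long_op a s \<in> ops"
| zero: "0 \<in> L \<Longrightarrow> a \<in> L \<Longrightarrow> a \<noteq> 0 \<Longrightarrow> zero_op a t \<in> ops"

inductive_set op_words :: "((int \<Rightarrow> 'a) \<Rightarrow> int \<Rightarrow> 'a) set" where
  Nil: "id \<in> op_words"
| Cons: "f \<in> ops \<Longrightarrow> g \<in> op_words \<Longrightarrow> f \<circ> g \<in> op_words"

lemma op_words_comp:
  assumes "f \<in> op_words" "g \<in> op_words" shows "f \<circ> g \<in> op_words"
  using assms by induction (auto simp: comp_assoc intro: op_words.intros)

lemma ops_in_op_words: "f \<in> ops \<Longrightarrow> f \<in> op_words"
  using op_words.Cons[OF _ op_words.Nil] by simp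

lemma uminus_label_iff [simp]: "- r \<in> L \<longleftrightarrow> r \<in> L"
  using uminus_label[of r] uminus_label[of "- r"] by auto

lemma weight_uminus [simp]: "weight (- r) = weight r"
  by (simp add: weight_def)

lemma weight_neq_0: "r \<in> L \<Longrightarrow> weight r \<noteq> 0"
  using two_neq_0 by (auto simp: weight_def)

lemma \<sigma>_two [simp]: "\<sigma> 2 = 2"
  by (metis hom_add hom_one one_add_one)

lemma form_add_left: "form (\<lambda>r. u r + v r) w = form u w + form v w"
  by (simp add: form_def hom_add algebra_simps sum.distrib)

lemma form_add_right: "form u (\<lambda>r. v r + w r) = form u v + form u w"
  by (simp add: form_def algebra_simps sum.distrib)

lemma form_axis_left:
  assumes "c \<in> L" "\<And>r. r \<in> L \<Longrightarrow> r \<noteq> c \<Longrightarrow> v r = 0"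
  shows "form v w = weight c * \<sigma> (v c) * w (- c)"
proof -
  have "form v w = (\<Sum>r\<in>L. if r = c then weight c * \<sigma> (v c) * w (- c) else 0)"
    unfolding form_def using assms(2) by (intro sum.cong) auto
  then show ?thesis using assms(1) finite_labels by simp
qed

lemma form_axis_right:
  assumes "c \<in> L" "\<And>r. r \<in> L \<Longrightarrow> r \<noteq> c \<Longrightarrow> w r = 0"
  shows "form v w = weight c * \<sigma> (v (- c)) * w c"
proof -
  have "form v w = (\<Sum>r\<in>L. if r = - c then weight c * \<sigma> (v (- c)) * w c else 0)"
    unfolding form_def using assms(2) by (intro sum.cong) auto
  then show ?thesis using assms(1) finite_labels by simp
qed

lemma form_point_left: "a \<in> L \<Longrightarrow> form (point a x) w = weight a * \<sigma> x * w (- a)"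
  by (subst form_axis_left[of a]) (auto simp: point_def)

lemma form_point_right: "a \<in> L \<Longrightarrow> form v (point a x) = weight a * \<sigma> (v (- a)) * x"
  by (subst form_axis_right[of a]) (auto simp: point_def)

text \<open>Expanding both arguments, the extra terms cancel: for \<open>long_op\<close> by skewness
  of \<open>s\<close>, for \<open>zero_op\<close> because two terms \<open>- t * \<sigma> t\<close>
  meet the weight 2 at the label 0.\<close>

lemma form_ops:
  assumes "f \<in> ops" shows "form (f v) (f w) = form v w"
  using assms
proof cases
  case (short a b t)
  then show ?thesis
    by (simp add: short_op_def form_add_left form_add_right form_point_left form_point_right)
      (simp add: weight_def point_def hom_simps algebra_simps)
next
  case (long a s)
  from long(1-3) show ?thesis
    by (simp add: long_op_def form_add_left form_add_right form_point_left form_point_right)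
      (simp add: weight_def point_def hom_simps long(4) algebra_simps)
next
  case (zero a t)
  then show ?thesis
    by (simp add: zero_op_def form_add_left form_add_right form_point_left form_point_right)
      (simp add: weight_def point_def hom_simps algebra_simps)
qed

lemma form_op_words:
  assumes "f \<in> op_words" shows "form (f v) (f w) = form v w"
  using assms by (induction arbitrary: v w) (auto simp: form_ops)

text \<open>Functions on \<open>int\<close> carry junk values outside \<open>L\<close>; a matrix
  determines a column only on \<open>L\<close>, so the operations must not look elsewhere.\<close>

lemma ops_cong:
  assumes "f \<in> ops" "\<And>r. r \<in> L \<Longrightarrow> v r = w r" "r \<in> L"
  shows "f v r = f w r"
  using assms
  by (cases) (auto simp: short_op_def long_op_def zero_op_def)

text \<open>Negating the parameter undoes the operation; for \<open>zero_op\<close> the quadratic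
  terms add up to zero.\<close>

lemma ops_inverse:
  assumes "f \<in> ops" obtains g where "g \<in> ops" "g \<circ> f = id"
  using assms
proof cases
  case (short a b t)
  then have "short_op a b (- t) \<circ> f = id"
    by (auto simp: fun_eq_iff short_op_def point_def hom_simps algebra_simps)
  with short show ?thesis by (auto intro: that ops.short)
next
  case (long a s)
  then have "long_op a (- s) \<circ> f = id"
    by (auto simp: fun_eq_iff long_op_def point_def hom_simps algebra_simps)
  moreover have "long_op a (- s) \<in> ops"
    using long(2,3) by (rule ops.long) (simp add: hom_simps long(4))
  ultimately show ?thesis by (intro that)
next
  case (zero a t)
  then have "zero_op a (- t) \<circ> f = id"
    by (auto simp: fun_eq_iff zero_op_def point_def hom_simps algebra_simps)
  with zero show ?thesis by (auto intro: that ops.zero)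
qed

subsection \<open>Reducing a hyperbolic family of vectors\<close>

definition axis :: "int \<Rightarrow> (int \<Rightarrow> 'a) \<Rightarrow> bool" where
  "axis c v \<longleftrightarrow> c \<in> L \<and> (\<forall>r\<in>L. r \<noteq> c \<longrightarrow> v r = 0)"

text \<open>The vectors \<open>w\<close> that clearing the entries of \<open>v\<close> other than the pivot \<open>v p\<close> leaves alone.\<close>

definition kept :: "int \<Rightarrow> (int \<Rightarrow> 'a) \<Rightarrow> (int \<Rightarrow> 'a) \<Rightarrow> bool" where
  "kept p v w \<longleftrightarrow> (\<exists>c. axis c w \<and> c \<noteq> 0 \<and> c \<noteq> p \<and> (c = - p \<or> v (- c) = 0))"

text \<open>Each nonzero entry is cleared against the pivot \<open>v p\<close>. The entry at
  \<open>- p\<close> absorbs all side effects and is left to \<open>clear\<close>.\<close>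

lemma clear_short:
  assumes "p \<in> L" "p \<noteq> 0" "v p \<noteq> 0"
  shows "\<exists>f\<in>op_words. f v p = v p \<and> (\<forall>r\<in>L - {0, p, - p}. f v r = 0) \<and>
           (\<forall>w. kept p v w \<longrightarrow> f w = w)"
  using assms(3)
proof (induction "card {r \<in> L - {0, p, - p}. v r \<noteq> 0}" arbitrary: v rule: less_induct)
  case less
  show ?case
  proof (cases "\<exists>r\<in>L - {0, p, - p}. v r \<noteq> 0")
    case False
    then show ?thesis by (intro bexI[of _ id]) (auto intro: op_words.Nil)
  next
    case True
    then obtain r where r: "r \<in> L" "r \<noteq> 0" "r \<noteq> p" "r \<noteq> - p" "v r \<noteq> 0" by auto
    \<comment> \<open>Besides \<open>r\<close>, only the entry at \<open>- p\<close> changes, so the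
      number of entries to be cleared drops.\<close>
    define g where "g = short_op r p (- (v r / v p))"
    have g: "g \<in> ops" unfolding g_def using r assms by (intro ops.short) auto
    have other: "g v x = v x" if "x \<noteq> r" "x \<noteq> - p" for x
      using that by (simp add: g_def short_op_def point_def)
    have "g v r = 0"
      using r less.prems by (simp add: g_def short_op_def point_def)
    then have "{x \<in> L - {0, p, - p}. g v x \<noteq> 0} \<subset> {x \<in> L - {0, p, - p}. v x \<noteq> 0}"
      using r other by (auto simp: psubset_eq) (metis other)+
    then have "card {x \<in> L - {0, p, - p}. g v x \<noteq> 0} < card {x \<in> L - {0, p, - p}. v x \<noteq> 0}"
      using finite_labels by (intro psubset_card_mono) auto
    moreover have pp: "g v p = v p" using other[of p] r assms by auto
    ultimately obtain f where f: "f \<in> op_words" "f (g v) p = g v p"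
      "\<forall>x\<in>L - {0, p, - p}. f (g v) x = 0" "\<forall>w. kept p (g v) w \<longrightarrow> f w = w"
      using less.hyps[of "g v"] less.prems by auto
    \<comment> \<open>\<open>g\<close> reads only the entries at \<open>p\<close> and
      \<open>- r\<close>. Both vanish in \<open>w\<close>: the case \<open>c = - r\<close> would
      force \<open>r = p\<close> or \<open>v r = 0\<close>.\<close>
    have "(f \<circ> g) w = w" if kept: "kept p v w" for w
    proof -
      obtain c where c: "axis c w" "c \<noteq> 0" "c \<noteq> p" "c = - p \<or> v (- c) = 0"
        using kept unfolding kept_def by blast
      have "w p = 0" using c assms by (auto simp: axis_def)
      moreover have "w (- r) = 0" using c r by (cases "c = - r") (auto simp: axis_def)
      ultimately have "g w = w" by (simp add: g_def short_op_def point_def)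
      moreover have "kept p (g v) w"
        unfolding kept_def using c other[of "- c"] r
        by (intro exI[of _ c]) (cases "- c = r"; auto)
      ultimately show ?thesis using f by simp
    qed
    then show ?thesis
      using f pp g by (intro bexI[of _ "f \<circ> g"]) (auto intro: op_words_comp ops_in_op_words)
  qed
qed

text \<open>After \<open>clear_short\<close>, a \<open>zero_op\<close> removes the entry at 0 and a
  \<open>long_op\<close> the one at \<open>- p\<close>. Isotropy is what makes the parameter of the
  latter skew.\<close>

lemma clear:
  assumes p: "p \<in> L" "p \<noteq> 0" "v p \<noteq> 0" and iso: "form v v = 0"
  shows "\<exists>f\<in>op_words. f v p = v p \<and> axis p (f v) \<and> (\<forall>w. kept p v w \<longrightarrow> f w = w)"
proof -
  have kept0: "w p = 0" "w 0 = 0" if "kept p u w" "0 \<in> L" for u w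
    using that p by (auto simp: kept_def axis_def)
  have keptp: "w p = 0" if "kept p u w" for u w
    using that p by (auto simp: kept_def axis_def)
  obtain f where f: "f \<in> op_words" "f v p = v p" "\<forall>r\<in>L - {0, p, - p}. f v r = 0"
    "\<forall>w. kept p v w \<longrightarrow> f w = w"
    using clear_short[of p v] p by auto
  have "\<exists>g\<in>op_words. g v p = v p \<and> (\<forall>r\<in>L - {p, - p}. g v r = 0) \<and> (\<forall>w. kept p v w \<longrightarrow> g w = w)"
  proof (cases "0 \<in> L")
    case False
    then show ?thesis using f by (intro bexI[of _ f]) auto
  next
    case True
    \<comment> \<open>Only the entries at 0 and \<open>- p\<close> change, and only those at 0 and
      \<open>p\<close> are read, where kept vectors vanish.\<close>
    define g where "g = zero_op p (- (f v 0 / f v p))"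
    have "g \<in> ops" unfolding g_def using True p by (intro ops.zero) auto
    moreover have "g (f v) p = v p" "\<forall>r\<in>L - {p, - p}. g (f v) r = 0"
      using f p by (auto simp: g_def zero_op_def point_def)
    moreover have "g w = w" if "kept p v w" for w
      using kept0[OF that True] by (simp add: g_def zero_op_def point_def)
    ultimately show ?thesis
      using f by (intro bexI[of _ "g \<circ> f"]) (auto intro: op_words.Cons)
  qed
  then obtain g where g: "g \<in> op_words" "g v p = v p" "\<forall>r\<in>L - {p, - p}. g v r = 0"
    "\<forall>w. kept p v w \<longrightarrow> g w = w" by auto
  define u where "u = g v"
  have "form u u = 0" using form_op_words[OF g(1)] iso by (simp add: u_def)
  moreover have "form u u = (\<Sum>r\<in>{p, - p}. weight r * \<sigma> (u r) * u (- r))"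
    unfolding form_def using g(3) p finite_labels
    by (intro sum.mono_neutral_right) (auto simp: u_def)
  \<comment> \<open>Divided by \<open>\<sigma> (u p) * u p\<close>, this equation says that
    \<open>u (- p) / u p\<close> is skew.\<close>
  ultimately have skew: "\<sigma> (u p) * u (- p) + \<sigma> (u (- p)) * u p = 0"
    using p by (simp add: weight_def)
  have up: "u p \<noteq> 0" "\<sigma> (u p) \<noteq> 0" using g p by (auto simp: u_def)
  define s where "s = - (u (- p) / u p)"
  have "\<sigma> s = - s"
    using skew up by (simp add: s_def hom_simps divide_simps) (simp add: algebra_simps add_eq_0_iff)
  then have op: "long_op p s \<in> ops" using p by (intro ops.long)
  have "long_op p s u p = v p" "axis p (long_op p s u)"
    using g p up by (auto simp: long_op_def point_def axis_def u_def s_def)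
  moreover have "long_op p s w = w" if "kept p v w" for w
    using keptp[OF that] by (simp add: long_op_def point_def)
  ultimately show ?thesis
    using g op by (intro bexI[of _ "long_op p s \<circ> g"]) (auto intro: op_words.Cons simp: u_def)
qed

section \<open>Isotropy and orthogonality of the columns\<close>

lemma isotropic_nonzero_label:
  assumes "form v v = 0" "\<exists>r\<in>L. v r \<noteq> 0"
  obtains r where "r \<in> L" "r \<noteq> 0" "v r \<noteq> 0"
proof (rule ccontr)
  assume "\<not> thesis"
  then have *: "\<forall>r\<in>L. r \<noteq> 0 \<longrightarrow> v r = 0" using that by blast
  with assms have "0 \<in> L" "v 0 \<noteq> 0" by metis+
  \<comment> \<open>A vector supported at 0 has norm \<open>2 * \<sigma> (v 0) * v 0\<close>, which
    is nonzero because 2 is.\<close>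
  then have "form v v = weight 0 * \<sigma> (v 0) * v 0"
    using * form_axis_left[of 0 v v] by simp
  then show False using assms \<open>0 \<in> L\<close> \<open>v 0 \<noteq> 0\<close> weight_neq_0 by simp
qed

text \<open>\<open>M c\<close> is column \<open>c\<close> of a matrix; the condition is the unitary
  equation read entry by entry.\<close>

definition isometric :: "(int \<Rightarrow> int \<Rightarrow> 'a) \<Rightarrow> bool" where
  "isometric M \<longleftrightarrow> (\<forall>c\<in>L. \<forall>c'\<in>L. form (M c) (M c') = (if c' = - c then weight c else 0))"

lemma isometric_op_words: "isometric M \<Longrightarrow> f \<in> op_words \<Longrightarrow> isometric (\<lambda>c. f (M c))"
  by (simp add: isometric_def form_op_words)

lemma isometric_iso: "isometric M \<Longrightarrow> c \<in> L \<Longrightarrow> c \<noteq> 0 \<Longrightarrow> form (M c) (M c) = 0"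
  by (auto simp: isometric_def)

lemma isometric_nonzero: "isometric M \<Longrightarrow> c \<in> L \<Longrightarrow> \<exists>r\<in>L. M c r \<noteq> 0"
proof (rule ccontr)
  assume M: "isometric M" "c \<in> L" "\<not> (\<exists>r\<in>L. M c r \<noteq> 0)"
  then have "form (M c) (M (- c)) = 0" by (simp add: form_def)
  then show False using M weight_neq_0[of c] by (simp add: isometric_def)
qed

text \<open>A column supported at \<open>c\<close> pairs with column \<open>c'\<close> only through
  \<open>M c' (- c)\<close>, so orthogonality kills this entry. Thus a finished column
  \<open>c\<close> makes row \<open>- c\<close> trivial outside column \<open>- c\<close>.\<close>

lemma isometric_axis_row:
  assumes "isometric M" "axis c (M c)" "c' \<in> L" "c' \<noteq> - c"
  shows "M c' (- c) = 0"
proof -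
  have c: "c \<in> L" using assms by (simp add: axis_def)
  then have "weight c * \<sigma> (M c c) * M c' (- c) = 0"
    using assms form_axis_left[of c "M c" "M c'"] by (simp add: axis_def isometric_def)
  moreover have "M c c \<noteq> 0" using isometric_nonzero[OF assms(1) c] assms(2) by (auto simp: axis_def)
  ultimately show ?thesis using weight_neq_0[OF c] by simp
qed

text \<open>Finished columns force zeros in column \<open>i\<close>, so isotropy leaves a nonzero
  entry at some \<open>r\<close> with \<open>\<bar>r\<bar> \<ge> i\<close>. A label beyond
  \<open>i\<close> gives room for a short root operation that makes the pivot exactly 1; otherwise
  only a skew multiple of the entry at \<open>- i\<close> is available.\<close>

lemma pivot:
  assumes M: "isometric M" and i: "i \<in> L" "i > 0"
    and red: "\<And>c. c \<in> L \<Longrightarrow> c \<noteq> 0 \<Longrightarrow> \<bar>c\<bar> < i \<Longrightarrow> axis c (M c)"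
  shows "\<exists>f\<in>op_words. f (M i) i \<noteq> 0 \<and> (\<forall>c\<in>L. c \<noteq> 0 \<and> \<bar>c\<bar> < i \<longrightarrow> f (M c) = M c) \<and>
           ((\<exists>m\<in>L. m > i) \<longrightarrow> f (M i) i = 1)"
proof -
  define keeps where "keeps f \<longleftrightarrow> (\<forall>c\<in>L. c \<noteq> 0 \<and> \<bar>c\<bar> < i \<longrightarrow> f (M c) = M c)" for f
  have zero: "M c x = 0" if "c \<in> L" "c \<noteq> 0" "\<bar>c\<bar> < i" "x \<in> L" "\<bar>x\<bar> \<ge> i" for c x
    using red[OF that(1-3)] that by (auto simp: axis_def)
  \<comment> \<open>A finished column vanishes at every label of absolute value at least
    \<open>i\<close>, so operations that read only there fix it.\<close>
  have keeps_short: "keeps (short_op a b t)" if "a \<in> L" "b \<in> L" "\<bar>a\<bar> \<ge> i" "\<bar>b\<bar> \<ge> i" for a b t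
    using that zero by (auto simp: keeps_def short_op_def point_def)
  have keeps_long: "keeps (long_op a s)" if "a \<in> L" "\<bar>a\<bar> \<ge> i" for a s
    using that zero by (auto simp: keeps_def long_op_def point_def)
  \<comment> \<open>Column \<open>- x\<close> is finished, so row \<open>x\<close> vanishes in
    column \<open>i\<close>.\<close>
  have row: "M i x = 0" if "x \<in> L" "x \<noteq> 0" "\<bar>x\<bar> < i" for x
    using isometric_axis_row[OF M red[of "- x"], of i] that i by auto
  obtain r where r: "r \<in> L" "r \<noteq> 0" "M i r \<noteq> 0"
    using isotropic_nonzero_label[OF isometric_iso[OF M] isometric_nonzero[OF M], of i] i by auto
  then have r_ge: "\<bar>r\<bar> \<ge> i" using row by force
  have "\<exists>f\<in>op_words. f (M i) i \<noteq> 0 \<and> keeps f \<and> ((\<exists>m\<in>L. m > i) \<longrightarrow> f (M i) i = 1)"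
  proof (cases "\<exists>m\<in>L. m > i")
    case False
    have "\<bar>r\<bar> \<in> L" using r by (auto simp: abs_if)
    with False r_ge have "\<bar>r\<bar> = i" by force
    then have ri: "r = i \<or> r = - i" by auto
    show ?thesis
    proof (cases "M i i = 0")
      case True
      \<comment> \<open>The nonzero entry is now at \<open>- i\<close>; a nonzero skew multiple of
        it is added at \<open>i\<close>.\<close>
      obtain s where s: "s \<noteq> 0" "\<sigma> s = - s" using ex_skew by auto
      have "long_op (- i) s \<in> op_words"
        using i s by (intro ops_in_op_words ops.long) auto
      moreover have "long_op (- i) s (M i) i \<noteq> 0"
        using s True ri r by (auto simp: long_op_def point_def)
      ultimately show ?thesis
        using False keeps_long[of "- i" s] i by (intro bexI[of _ "long_op (- i) s"]) auto
    next
      case False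
      then show ?thesis
        using \<open>\<not> (\<exists>m\<in>L. m > i)\<close> by (intro bexI[of _ id]) (auto simp: keeps_def intro: op_words.Nil)
    qed
  next
    case True
    then obtain m where m: "m \<in> L" "m > i" by auto
    \<comment> \<open>A nonzero entry beyond \<open>i\<close> is needed as a source. If there is
      none at hand, the entry at \<open>r\<close> is copied to \<open>m\<close>, where the entry was
      0.\<close>
    have "\<exists>f\<in>op_words. keeps f \<and> (\<exists>q\<in>L. \<bar>q\<bar> > i \<and> f (M i) q \<noteq> 0)"
    proof (cases "\<bar>r\<bar> > i \<or> M i m \<noteq> 0")
      case True
      then have "\<exists>q\<in>L. \<bar>q\<bar> > i \<and> M i q \<noteq> 0"
      proof
        assume "M i m \<noteq> 0"
        then show ?thesis using m i by (intro bexI[of _ m]) auto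
      qed (use r in blast)
      then show ?thesis by (intro bexI[of _ id]) (auto simp: keeps_def intro: op_words.Nil)
    next
      case False
      with r_ge have ri: "r = i \<or> r = - i" by auto
      have "short_op m r 1 \<in> op_words"
        using m r ri i by (intro ops_in_op_words ops.short) auto
      moreover have "short_op m r 1 (M i) m \<noteq> 0"
        using False ri r m i by (auto simp: short_op_def point_def)
      then have "\<exists>q\<in>L. \<bar>q\<bar> > i \<and> short_op m r 1 (M i) q \<noteq> 0"
        using m i by (intro bexI[of _ m]) auto
      moreover have "keeps (short_op m r 1)" using m r r_ge i by (intro keeps_short) auto
      ultimately show ?thesis by blast
    qed
    then obtain f q where f: "f \<in> op_words" "keeps f" and q: "q \<in> L" "\<bar>q\<bar> > i" "f (M i) q \<noteq> 0"
      by auto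
    \<comment> \<open>The parameter solves \<open>f (M i) i + t * f (M i) q = 1\<close>; the second
      entry touched, at \<open>- q\<close>, is not \<open>i\<close>.\<close>
    define g where "g = short_op i q ((1 - f (M i) i) / f (M i) q)"
    have "g \<in> ops" unfolding g_def using i q by (intro ops.short) auto
    moreover have "g (f (M i)) i = 1"
      using q i by (auto simp: g_def short_op_def point_def)
    moreover have "keeps g" unfolding g_def using i q by (intro keeps_short) auto
    ultimately show ?thesis
      using f by (intro bexI[of _ "g \<circ> f"]) (auto simp: keeps_def intro: op_words.Cons)
  qed
  then show ?thesis by (auto simp: keeps_def)
qed

text \<open>The pairing of columns \<open>c\<close> and \<open>- c\<close> has value 1 and reduces
  to a single product. This is the origin of \<open>inverse (\<sigma> \<mu>)\<close>.\<close>

lemma isometric_axis_dual: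
  assumes "isometric M" "c \<in> L" "c \<noteq> 0" "axis c (M c)"
  shows "\<sigma> (M c c) * M (- c) (- c) = 1"
  using assms form_axis_left[of c "M c" "M (- c)"]
  by (auto simp: axis_def isometric_def weight_def)

text \<open>Create the pivot, clear column \<open>i\<close>, then clear column \<open>- i\<close>,
  whose own pivot is nonzero by \<open>isometric_axis_dual\<close>. Columns done earlier survive
  because they are \<open>kept\<close>.\<close>

lemma reduce_pair:
  assumes M: "isometric M" and i: "i \<in> L" "i > 0"
    and red: "\<And>c. c \<in> L \<Longrightarrow> c \<noteq> 0 \<Longrightarrow> \<bar>c\<bar> < i \<Longrightarrow> axis c (M c)"
  shows "\<exists>f\<in>op_words. axis i (f (M i)) \<and> axis (- i) (f (M (- i))) \<and>
           (\<forall>c\<in>L. c \<noteq> 0 \<and> \<bar>c\<bar> < i \<longrightarrow> f (M c) = M c) \<and>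
           ((\<exists>m\<in>L. m > i) \<longrightarrow> f (M i) i = 1)"
proof -
  obtain g where g: "g \<in> op_words" "g (M i) i \<noteq> 0"
    "\<And>c. c \<in> L \<Longrightarrow> c \<noteq> 0 \<Longrightarrow> \<bar>c\<bar> < i \<Longrightarrow> g (M c) = M c"
    "(\<exists>m\<in>L. m > i) \<longrightarrow> g (M i) i = 1"
    using pivot[OF M i red] by blast
  define N where "N = (\<lambda>c. g (M c))"
  have N: "isometric N" using isometric_op_words[OF M g(1)] by (simp add: N_def)
  have redN: "axis c (N c)" if "c \<in> L" "c \<noteq> 0" "\<bar>c\<bar> < i" for c
    using that red g(3) by (simp add: N_def)
  have "form (N i) (N i) = 0" using isometric_iso[OF N] i by simp
  then obtain h where h: "h \<in> op_words" "h (N i) i = N i i" "axis i (h (N i))"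
    "\<And>w. kept i (N i) w \<Longrightarrow> h w = w"
    using clear[of i "N i"] i g(2) by (auto simp: N_def)
  define P where "P = (\<lambda>c. h (N c))"
  have P: "isometric P" using isometric_op_words[OF N h(1)] by (simp add: P_def)
  have PN: "P c = N c" if "c \<in> L" "c \<noteq> 0" "\<bar>c\<bar> < i" for c
  proof -
    \<comment> \<open>Column \<open>c\<close> is finished, so row \<open>- c\<close> vanishes in
      column \<open>i\<close>, as \<open>kept\<close> demands.\<close>
    have "kept i (N i) (N c)"
      unfolding kept_def using that i redN[OF that] isometric_axis_row[OF N redN[OF that], of i]
      by (intro exI[of _ c]) auto
    then show ?thesis by (simp add: P_def h(4))
  qed
  have axP: "axis i (P i)" using h by (simp add: P_def)
  have "\<sigma> (P i i) * P (- i) (- i) = 1"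
    using isometric_axis_dual[OF P] i axP by auto
  then have "P (- i) (- i) \<noteq> 0" by auto
  moreover have "form (P (- i)) (P (- i)) = 0" using isometric_iso[OF P] i by simp
  ultimately obtain f where f: "f \<in> op_words" "axis (- i) (f (P (- i)))"
    "\<And>w. kept (- i) (P (- i)) w \<Longrightarrow> f w = w"
    using clear[of "- i" "P (- i)"] i by auto
  \<comment> \<open>The alternative \<open>c = - p\<close> of \<open>kept\<close>, with pivot label
    \<open>p = - i\<close>.\<close>
  have "kept (- i) (P (- i)) (P i)"
    unfolding kept_def using axP i by (intro exI[of _ i]) auto
  then have fi: "f (P i) = P i" by (rule f(3))
  have fP: "f (P c) = M c" if "c \<in> L" "c \<noteq> 0" "\<bar>c\<bar> < i" for c
  proof -
    have ax: "axis c (P c)" using PN redN that by simp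
    have "kept (- i) (P (- i)) (P c)"
      unfolding kept_def using that i ax isometric_axis_row[OF P ax, of "- i"]
      by (intro exI[of _ c]) auto
    then show ?thesis using f(3) PN[OF that] g(3)[OF that] by (simp add: N_def)
  qed
  show ?thesis
  proof (intro bexI[of _ "f \<circ> (h \<circ> g)"])
    show "f \<circ> (h \<circ> g) \<in> op_words" using f g h by (intro op_words_comp)
  qed (use f(2) fi fP axP g(4) h(2) in \<open>auto simp: P_def N_def\<close>)
qed

text \<open>The induction stays below \<open>l\<close>, so \<open>l\<close> itself is always a
  larger label and every pivot becomes 1; by duality the entry at the opposite label is then 1
  too.\<close>

lemma reduce_initial:
  assumes M: "isometric M" and L: "\<And>r. r \<noteq> 0 \<Longrightarrow> r \<in> L \<longleftrightarrow> \<bar>r\<bar> \<le> int l" and "n < l"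
  shows "\<exists>f\<in>op_words. \<forall>c\<in>L. c \<noteq> 0 \<and> \<bar>c\<bar> \<le> int n \<longrightarrow> axis c (f (M c)) \<and> f (M c) c = 1"
  using \<open>n < l\<close>
proof (induction n)
  case 0
  show ?case by (intro bexI[of _ id]) (auto intro: op_words.Nil)
next
  case (Suc n)
  then obtain f where f: "f \<in> op_words"
    "\<And>c. c \<in> L \<Longrightarrow> c \<noteq> 0 \<Longrightarrow> \<bar>c\<bar> \<le> int n \<Longrightarrow> axis c (f (M c)) \<and> f (M c) c = 1"
    using Suc_lessD by blast
  define N where "N = (\<lambda>c. f (M c))"
  have N: "isometric N" using isometric_op_words[OF M f(1)] by (simp add: N_def)
  let ?i = "int (Suc n)"
  have redN: "axis c (N c)" if "c \<in> L" "c \<noteq> 0" "\<bar>c\<bar> < ?i" for c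
    using f(2)[of c] that by (simp add: N_def)
  have i: "?i \<in> L" "?i > 0" using Suc L by auto
  have bigger: "\<exists>m\<in>L. m > ?i" using Suc L by (intro bexI[of _ "int l"]) auto
  obtain g where g: "g \<in> op_words" "axis ?i (g (N ?i))" "axis (- ?i) (g (N (- ?i)))"
    "\<And>c. c \<in> L \<Longrightarrow> c \<noteq> 0 \<Longrightarrow> \<bar>c\<bar> < ?i \<Longrightarrow> g (N c) = N c" "g (N ?i) ?i = 1"
    using reduce_pair[OF N i redN] bigger by blast
  have "g (N (- ?i)) (- ?i) = 1"
    using isometric_axis_dual[OF isometric_op_words[OF N g(1)] i(1)] g(2,5) by simp
  then have "axis c ((g \<circ> f) (M c)) \<and> (g \<circ> f) (M c) c = 1"
    if "c \<in> L" "c \<noteq> 0" "\<bar>c\<bar> \<le> ?i" for c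
  proof (cases "\<bar>c\<bar> = ?i")
    case True
    then have "c = ?i \<or> c = - ?i" by linarith
    then show ?thesis using g \<open>g (N (- ?i)) (- ?i) = 1\<close> by (auto simp: N_def)
  next
    case False
    then show ?thesis using that f(2) g(4) by (auto simp: N_def)
  qed
  then show ?case using f g by (intro bexI[of _ "g \<circ> f"]) (auto intro: op_words_comp)
qed

text \<open>The last pair of labels has no larger label to borrow from, hence the free parameter
  \<open>\<mu>\<close>.\<close>

lemma reduce:
  assumes M: "isometric M" and L: "\<And>r. r \<noteq> 0 \<Longrightarrow> r \<in> L \<longleftrightarrow> \<bar>r\<bar> \<le> int l" and l: "l > 0"
  shows "\<exists>f\<in>op_words. \<exists>\<alpha> \<mu>. \<mu> \<noteq> 0 \<and> (0 \<in> L \<longrightarrow> \<alpha> * \<sigma> \<alpha> = 1) \<and>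
    (\<forall>c\<in>L. \<forall>r\<in>L. f (M c) r =
       (if r \<noteq> c then 0 else if c = 0 then \<alpha> else if c = int l then \<mu>
        else if c = - int l then inverse (\<sigma> \<mu>) else 1))"
proof -
  obtain f where f: "f \<in> op_words"
    "\<And>c. c \<in> L \<Longrightarrow> c \<noteq> 0 \<Longrightarrow> \<bar>c\<bar> < int l \<Longrightarrow> axis c (f (M c)) \<and> f (M c) c = 1"
    using reduce_initial[OF M L, of "l - 1"] l by force
  define N where "N = (\<lambda>c. f (M c))"
  have N: "isometric N" using isometric_op_words[OF M f(1)] by (simp add: N_def)
  have redN: "axis c (N c)" if "c \<in> L" "c \<noteq> 0" "\<bar>c\<bar> < int l" for c
    using f(2)[of c] that by (simp add: N_def)
  have i: "int l \<in> L" "int l > 0" using L l by auto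
  obtain g where g: "g \<in> op_words" "axis (int l) (g (N (int l)))" "axis (- int l) (g (N (- int l)))"
    "\<And>c. c \<in> L \<Longrightarrow> c \<noteq> 0 \<Longrightarrow> \<bar>c\<bar> < int l \<Longrightarrow> g (N c) = N c"
    using reduce_pair[OF N i redN] by blast
  define P where "P = (\<lambda>c. g (N c))"
  have P: "isometric P" using isometric_op_words[OF N g(1)] by (simp add: P_def)
  define \<mu> where "\<mu> = P (int l) (int l)"
  have dual: "\<sigma> \<mu> * P (- int l) (- int l) = 1"
    using isometric_axis_dual[OF P i(1)] g(2) i by (simp add: P_def \<mu>_def)
  then have \<mu>: "\<mu> \<noteq> 0" "P (- int l) (- int l) = inverse (\<sigma> \<mu>)"
    by (auto simp: inverse_unique)
  have ax: "axis c (P c)" "\<bar>c\<bar> < int l \<Longrightarrow> P c c = 1" if "c \<in> L" "c \<noteq> 0" for c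
  proof -
    have "\<bar>c\<bar> < int l \<or> c = int l \<or> c = - int l" using that L[of c] by auto
    then show "axis c (P c)" using that f(2) g by (auto simp: P_def N_def)
    show "P c c = 1" if "\<bar>c\<bar> < int l" using that \<open>c \<in> L\<close> \<open>c \<noteq> 0\<close> f(2) g(4) by (simp add: P_def N_def)
  qed
  \<comment> \<open>Column \<open>- r\<close> is finished, so row \<open>r\<close> vanishes in
    column 0.\<close>
  have "P 0 r = 0" if "0 \<in> L" "r \<in> L" "r \<noteq> 0" for r
    using that isometric_axis_row[OF P ax(1)[of "- r"], of 0] by simp
  then have ax0: "axis 0 (P 0)" if "0 \<in> L" using that by (simp add: axis_def)
  \<comment> \<open>The norm of column 0 is 2 on the one hand and
    \<open>2 * \<sigma> (P 0 0) * P 0 0\<close> on the other.\<close>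
  have alpha: "P 0 0 * \<sigma> (P 0 0) = 1" if "0 \<in> L"
    using form_axis_left[of 0 "P 0" "P 0"] P ax0 that two_neq_0
    by (auto simp: axis_def isometric_def weight_def mult.commute)
  have "P c r = (if r \<noteq> c then 0 else if c = 0 then P 0 0 else if c = int l then \<mu>
        else if c = - int l then inverse (\<sigma> \<mu>) else 1)" if "c \<in> L" "r \<in> L" for c r
  proof (cases "r = c")
    case False
    have "axis c (P c)" using ax0 ax that by (cases "c = 0") auto
    then show ?thesis using False that by (auto simp: axis_def)
  next
    case True
    have "c = 0 \<or> \<bar>c\<bar> < int l \<or> c = int l \<or> c = - int l" using that L[of c] by auto
    then show ?thesis using True that ax(2)[of c] \<mu> by (auto simp: \<mu>_def)
  qed
  then have entries: "\<forall>c\<in>L. \<forall>r\<in>L. (g \<circ> f) (M c) r =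
       (if r \<noteq> c then 0 else if c = 0 then P 0 0 else if c = int l then \<mu>
        else if c = - int l then inverse (\<sigma> \<mu>) else 1)"
    by (simp only: P_def N_def comp_apply) blast
  have "g \<circ> f \<in> op_words" using f g by (intro op_words_comp)
  then show ?thesis using \<mu>(1) alpha entries
    by (intro bexI[of _ "g \<circ> f"] exI[of _ "P 0 0"] exI[of _ \<mu>] conjI impI)
qed

end

subsection \<open>Matrices indexed by signed labels\<close>

definition labels :: "nat \<Rightarrow> int set" where
  "labels d = {a. \<bar>a\<bar> \<le> int (d div 2) \<and> (a = 0 \<longrightarrow> odd d)}"

lemma uminus_labels [simp]: "- a \<in> labels d \<longleftrightarrow> a \<in> labels d"
  by (simp add: labels_def)

lemma finite_labels: "finite (labels d)"
  by (rule finite_subset[of _ "{- int (d div 2)..int (d div 2)}"]) (auto simp: labels_def)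

lemma label_pos_even: "label_pos (2 * l) a = nat (if a \<ge> 0 then a - 1 else int l - a - 1)"
  by (simp add: label_pos_def Let_def)

lemma label_pos_odd: "label_pos (Suc (2 * l)) a = nat (if a \<ge> 0 then a else int l - a)"
  by (simp add: label_pos_def Let_def)

lemma labels_even: "a \<in> labels (2 * l) \<longleftrightarrow> \<bar>a\<bar> \<le> int l \<and> a \<noteq> 0"
  by (auto simp: labels_def)

lemma labels_odd: "a \<in> labels (Suc (2 * l)) \<longleftrightarrow> \<bar>a\<bar> \<le> int l"
  by (auto simp: labels_def)

lemmas label_simps = label_pos_even label_pos_odd labels_even labels_odd

lemma half_cases: obtains l where "d = 2 * l" | l where "d = Suc (2 * l)"
  by (metis evenE oddE Suc_eq_plus1)

lemma label_pos_less [simp]: "a \<in> labels d \<Longrightarrow> label_pos d a < d"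
  by (cases d rule: half_cases) (auto simp: label_simps split: if_splits)

lemma label_pos_eq_iff [simp]:
  assumes "a \<in> labels d" "b \<in> labels d"
  shows "label_pos d a = label_pos d b \<longleftrightarrow> a = b"
  using assms by (cases d rule: half_cases) (auto simp: label_simps split: if_splits)

lemma ex_label:
  assumes "p < d" obtains a where "a \<in> labels d" "p = label_pos d a"
proof (cases d rule: half_cases)
  case (1 l)
  show ?thesis
    \<comment> \<open>Without the label 0, positions run one behind the positive labels.\<close>
    by (rule that[of "if int p < int l then int p + 1 else int l - int p - 1"])
      (use assms 1 in \<open>auto simp: label_simps\<close>)
next
  case (2 l)
  show ?thesis
    \<comment> \<open>Here the label 0 takes position 0, so nothing is shifted.\<close>
    by (rule that[of "if int p \<le> int l then int p else int l - int p"])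
      (use assms 2 in \<open>auto simp: label_simps\<close>)
qed

lemma bij_betw_label_pos: "bij_betw (label_pos d) (labels d) {0..<d}"
  unfolding bij_betw_def inj_on_def by (auto intro: ex_label)

definition entry :: "nat \<Rightarrow> 'a mat \<Rightarrow> int \<Rightarrow> int \<Rightarrow> 'a" where
  "entry d X r c = X $$ (label_pos d r, label_pos d c)"

lemma mat_eq_entryI:
  assumes "X \<in> carrier_mat d d" "Y \<in> carrier_mat d d"
    and "\<And>r c. r \<in> labels d \<Longrightarrow> c \<in> labels d \<Longrightarrow> entry d X r c = entry d Y r c"
  shows "X = Y"
proof (rule eq_matI)
  fix i j assume "i < dim_row Y" "j < dim_col Y"
  then obtain r c where "r \<in> labels d" "i = label_pos d r" "c \<in> labels d" "j = label_pos d c"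
    using assms(2) by (auto elim!: ex_label[of i d] ex_label[of j d])
  then show "X $$ (i, j) = Y $$ (i, j)" using assms(3)[of r c] by (simp add: entry_def)
qed (use assms in auto)

lemma entry_mult:
  assumes "X \<in> carrier_mat d d" "Y \<in> carrier_mat d d" "r \<in> labels d" "c \<in> labels d"
  shows "entry d (X * Y) r c = (\<Sum>k\<in>labels d. entry d X r k * entry d Y k c)"
  using assms sum.reindex_bij_betw[OF bij_betw_label_pos,
      of "\<lambda>k. X $$ (label_pos d r, k) * Y $$ (k, label_pos d c)"]
  by (simp add: entry_def scalar_prod_def)

lemma unit_mat_carrier [simp]: "unit_mat d a b \<in> carrier_mat d d"
  by (simp add: unit_mat_def)

lemma entry_one [simp]:
  "r \<in> labels d \<Longrightarrow> c \<in> labels d \<Longrightarrow> entry d (1\<^sub>m d) r c = (if r = c then 1 else 0)"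
  by (simp add: entry_def)

lemma entry_unit_mat [simp]:
  "r \<in> labels d \<Longrightarrow> c \<in> labels d \<Longrightarrow> a \<in> labels d \<Longrightarrow> b \<in> labels d \<Longrightarrow>
   entry d (unit_mat d a b) r c = (if r = a \<and> c = b then 1 else 0)"
  by (simp add: entry_def unit_mat_def)

lemma entry_add [simp]:
  "Y \<in> carrier_mat d d \<Longrightarrow> r \<in> labels d \<Longrightarrow> c \<in> labels d \<Longrightarrow>
   entry d (X + Y) r c = entry d X r c + entry d Y r c"
  by (simp add: entry_def)

lemma entry_minus [simp]:
  "Y \<in> carrier_mat d d \<Longrightarrow> r \<in> labels d \<Longrightarrow> c \<in> labels d \<Longrightarrow>
   entry d (X - Y) r c = entry d X r c - entry d Y r c"
  by (simp add: entry_def)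

lemma entry_smult [simp]:
  "X \<in> carrier_mat d d \<Longrightarrow> r \<in> labels d \<Longrightarrow> c \<in> labels d \<Longrightarrow>
   entry d (k \<cdot>\<^sub>m X) r c = k * entry d X r c"
  by (simp add: entry_def)

lemma entry_addrow [simp]:
  "X \<in> carrier_mat d d \<Longrightarrow> r \<in> labels d \<Longrightarrow> c \<in> labels d \<Longrightarrow> a \<in> labels d \<Longrightarrow> b \<in> labels d \<Longrightarrow>
   entry d (addrow k (label_pos d a) (label_pos d b) X) r c =
     (if r = a then k * entry d X b c + entry d X r c else entry d X r c)"
  by (auto simp: entry_def)

lemma unit_mat_mult_carrier [simp]: "B \<in> carrier_mat d n \<Longrightarrow> unit_mat d a b * B \<in> carrier_mat d n"
  by (rule mult_carrier_mat) simp_all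

declare minus_carrier_mat [simp]

lemma entry_unit_mat_mult [simp]:
  assumes "B \<in> carrier_mat d d" "a \<in> labels d" "b \<in> labels d" "r \<in> labels d" "c \<in> labels d"
  shows "entry d (unit_mat d a b * B) r c = (if r = a then entry d B b c else 0)"
proof -
  have "entry d (unit_mat d a b * B) r c =
      (\<Sum>k\<in>labels d. if k = b then (if r = a then entry d B b c else 0) else 0)"
    using assms by (subst entry_mult) (auto intro!: sum.cong)
  then show ?thesis using assms finite_labels by simp
qed

section \<open>The matrix of the form in label coordinates\<close>

lemma form_mat_carrier [simp]: "form_mat d \<in> carrier_mat d d"
  by (cases d rule: half_cases) (auto simp: form_mat_def hyperbolic_mat_def Let_def intro!: carrier_matI)

lemma index_form_mat_even:
  "i < 2 * l \<Longrightarrow> j < 2 * l \<Longrightarrow>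
   form_mat (2 * l) $$ (i, j) = (if j = i + l \<or> i = j + l then 1 else 0)"
  by (auto simp: form_mat_def hyperbolic_mat_def Let_def)

lemma index_form_mat_odd:
  assumes "i < Suc (2 * l)" "j < Suc (2 * l)"
  shows "form_mat (Suc (2 * l)) $$ (i, j) =
    (if i = 0 \<and> j = 0 then 2
     else if i \<noteq> 0 \<and> j \<noteq> 0 \<and> (j = i + l \<or> i = j + l) then 1 else 0)"
proof (cases i; cases j)
  fix i' j' assume "i = Suc i'" "j = Suc j'"
  then show ?thesis using assms by (auto simp: form_mat_def hyperbolic_mat_def Let_def)
qed (use assms in \<open>simp_all add: form_mat_def hyperbolic_mat_def Let_def\<close>)

lemma entry_form_mat:
  assumes "a \<in> labels d" "b \<in> labels d"
  shows "entry d (form_mat d) a b = (if b = - a then if a = 0 then 2 else 1 else 0)"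
proof (cases d rule: half_cases)
  case (1 l)
  have less: "label_pos (2 * l) a < 2 * l" "label_pos (2 * l) b < 2 * l"
    using assms label_pos_less unfolding 1 by blast+
  \<comment> \<open>Opposite labels are exactly \<open>l\<close> positions apart, which is where the
    identity blocks have their ones.\<close>
  have "label_pos (2 * l) b = label_pos (2 * l) a + l \<or> label_pos (2 * l) a = label_pos (2 * l) b + l
      \<longleftrightarrow> b = - a"
    using assms unfolding 1 label_simps by (auto split: if_splits)
  then show ?thesis
    using assms unfolding 1 entry_def index_form_mat_even[OF less] labels_even by simp
next
  case (2 l)
  have less: "label_pos (Suc (2 * l)) a < Suc (2 * l)" "label_pos (Suc (2 * l)) b < Suc (2 * l)"
    using assms label_pos_less unfolding 2 by blast+
  have "label_pos (Suc (2 * l)) a = 0 \<longleftrightarrow> a = 0" "label_pos (Suc (2 * l)) b = 0 \<longleftrightarrow> b = 0"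
    using assms unfolding 2 label_simps by (auto split: if_splits)
  moreover have "label_pos (Suc (2 * l)) b = label_pos (Suc (2 * l)) a + l \<or>
      label_pos (Suc (2 * l)) a = label_pos (Suc (2 * l)) b + l \<longleftrightarrow> b = - a" if "a \<noteq> 0" "b \<noteq> 0"
    using assms that unfolding 2 label_simps by (auto split: if_splits)
  ultimately show ?thesis
    unfolding 2 entry_def index_form_mat_odd[OF less] by (cases "a = 0"; cases "b = 0") simp_all
qed

lemma mat_diag_entryI:
  assumes "X \<in> carrier_mat d d"
    and "\<And>r c. r \<in> labels d \<Longrightarrow> c \<in> labels d \<Longrightarrow>
           entry d X r c = (if r = c then f (label_pos d c) else 0)"
  shows "X = mat_diag d f"
  using assms by (intro mat_eq_entryI[of _ d]) (auto simp: entry_def mat_diag_def)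

section \<open>Products of lists of matrices\<close>

lemma mat_list_prod_carrier [simp]:
  "set Xs \<subseteq> carrier_mat d d \<Longrightarrow> mat_list_prod d Xs \<in> carrier_mat d d"
  by (induction Xs) (auto simp: mat_list_prod_def)

lemma mat_list_prod_Nil [simp]: "mat_list_prod d [] = 1\<^sub>m d"
  by (simp add: mat_list_prod_def)

lemma mat_list_prod_Cons [simp]: "mat_list_prod d (X # Xs) = X * mat_list_prod d Xs"
  by (simp add: mat_list_prod_def)

lemma mat_list_prod_snoc:
  "set Xs \<subseteq> carrier_mat d d \<Longrightarrow> X \<in> carrier_mat d d \<Longrightarrow>
   mat_list_prod d (Xs @ [X]) = mat_list_prod d Xs * X"
  by (induction Xs) (auto simp: assoc_mult_mat[of _ d d _ d _ d])

lemma elementary_matrices_carrier: "X \<in> elementary_matrices \<sigma> d \<Longrightarrow> X \<in> carrier_mat d d"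
  by (induction rule: elementary_matrices.induct) auto

subsection \<open>Elementary matrices as row operations\<close>

locale unitary_matrices = unitary_form \<sigma> "labels d" for \<sigma> :: "'a::field \<Rightarrow> 'a" and d :: nat
begin

definition short_mat :: "int \<Rightarrow> int \<Rightarrow> 'a \<Rightarrow> 'a mat" where
  "short_mat a b t = 1\<^sub>m d + t \<cdot>\<^sub>m unit_mat d a b - \<sigma> t \<cdot>\<^sub>m unit_mat d (- b) (- a)"

definition long_mat :: "int \<Rightarrow> 'a \<Rightarrow> 'a mat" where
  "long_mat a s = 1\<^sub>m d + s \<cdot>\<^sub>m unit_mat d (- a) a"

definition zero_mat :: "int \<Rightarrow> 'a \<Rightarrow> 'a mat" where
  "zero_mat a t = 1\<^sub>m d + t \<cdot>\<^sub>m unit_mat d 0 a - (2 * \<sigma> t) \<cdot>\<^sub>m unit_mat d (- a) 0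
     - (t * \<sigma> t) \<cdot>\<^sub>m unit_mat d (- a) a"

lemma mats_carrier [simp]:
  "short_mat a b t \<in> carrier_mat d d" "long_mat a s \<in> carrier_mat d d" "zero_mat a t \<in> carrier_mat d d"
  by (simp_all add: short_mat_def long_mat_def zero_mat_def)

text \<open>The two matrix units trade places, and \<open>\<sigma> (\<sigma> t) = t\<close> restores
  the first coefficient. This reaches sign patterns and orders of indices that the generators do not
  list directly.\<close>

lemma short_mat_swap:
  assumes "a \<in> labels d" "b \<in> labels d"
  shows "short_mat a b t = short_mat (- b) (- a) (- \<sigma> t)"
  using assms
  by (intro mat_eq_entryI[of _ d]) (auto simp: short_mat_def hom_simps)

lemma short_mat_elementary:
  assumes "a \<in> labels d" "b \<in> labels d" "a \<noteq> 0" "b \<noteq> 0" "a \<noteq> b" "a \<noteq> - b"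
  shows "short_mat a b t \<in> elementary_matrices \<sigma> d"
proof -
  have pp: "short_mat a b t \<in> elementary_matrices \<sigma> d"
    if "a \<in> labels d" "b \<in> labels d" "a > 0" "b > 0" "a \<noteq> b" for a b t
    using elementary_matrices.pos_pos[of a d b t \<sigma>] that by (auto simp: short_mat_def labels_def)
  have pn: "short_mat a b t \<in> elementary_matrices \<sigma> d"
    if "a \<in> labels d" "b \<in> labels d" "a > 0" "b < 0" "a < - b" for a b t
    using elementary_matrices.pos_neg[of a d "- b" t \<sigma>] that by (auto simp: short_mat_def labels_def)
  have np: "short_mat a b t \<in> elementary_matrices \<sigma> d"
    if "a \<in> labels d" "b \<in> labels d" "a < 0" "b > 0" "- a < b" for a b t
    using elementary_matrices.neg_pos[of "- a" d b t \<sigma>] that by (auto simp: short_mat_def labels_def)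
  \<comment> \<open>Cases 1, 2 and 4 are generators as they stand; the others become generators
    after the swap.\<close>
  consider "a > 0" "b > 0" | "a > 0" "b < 0" "a < - b" | "a > 0" "b < 0" "- b < a"
    | "a < 0" "b > 0" "- a < b" | "a < 0" "b > 0" "b < - a" | "a < 0" "b < 0"
    using assms by linarith
  then show ?thesis
  proof cases
    case 1
    then show ?thesis using assms by (intro pp)
  next
    case 2
    then show ?thesis using assms by (intro pn)
  next
    case 3
    then show ?thesis using assms unfolding short_mat_swap[OF assms(1,2)] by (intro pn) simp_all
  next
    case 4
    then show ?thesis using assms by (intro np)
  next
    case 5
    then show ?thesis using assms unfolding short_mat_swap[OF assms(1,2)] by (intro np) simp_all
  next
    case 6
    then show ?thesis using assms unfolding short_mat_swap[OF assms(1,2)] by (intro pp) simp_all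
  qed
qed

lemma long_mat_elementary:
  assumes "a \<in> labels d" "a \<noteq> 0" "\<sigma> s = - s"
  shows "long_mat a s \<in> elementary_matrices \<sigma> d"
proof (cases "a > 0")
  case True
  have "a \<in> {1..int (d div 2)}" using assms True by (auto simp: labels_def)
  then show ?thesis
    unfolding long_mat_def
    by (rule elementary_matrices.long_neg) (use assms(3) in \<open>unfold skew_elements_def, blast\<close>)
next
  case False
  have "- a \<in> {1..int (d div 2)}" using assms False by (auto simp: labels_def)
  then have "1\<^sub>m d + s \<cdot>\<^sub>m unit_mat d (- a) (- (- a)) \<in> elementary_matrices \<sigma> d"
    by (rule elementary_matrices.long_pos) (use assms(3) in \<open>unfold skew_elements_def, blast\<close>)
  then show ?thesis unfolding long_mat_def by simp
qed

lemma zero_mat_elementary: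
  assumes "0 \<in> labels d" "a \<in> labels d" "a \<noteq> 0"
  shows "zero_mat a t \<in> elementary_matrices \<sigma> d"
proof (cases "a > 0")
  case True
  then show ?thesis
    using assms elementary_matrices.zero_pos[of d a t \<sigma>] by (auto simp: labels_def zero_mat_def)
next
  case False
  \<comment> \<open>The generator \<open>pos_zero\<close> with index \<open>- a\<close> has the same
    summands in another order.\<close>
  have "zero_mat a t = 1\<^sub>m d - (2 * \<sigma> t) \<cdot>\<^sub>m unit_mat d (- a) 0 + t \<cdot>\<^sub>m unit_mat d 0 (- (- a))
       - (t * \<sigma> t) \<cdot>\<^sub>m unit_mat d (- a) (- (- a))"
    using assms by (intro mat_eq_entryI[of _ d]) (auto simp: zero_mat_def)
  then show ?thesis
    using assms False elementary_matrices.pos_zero[of d "- a" \<sigma> t] by (auto simp: labels_def)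
qed

text \<open>\<open>X\<close> realises \<open>f\<close> on all columns of all square matrices
  \<open>B\<close>, compared at labels only.\<close>

definition acts :: "((int \<Rightarrow> 'a) \<Rightarrow> int \<Rightarrow> 'a) \<Rightarrow> 'a mat \<Rightarrow> bool" where
  "acts f X \<longleftrightarrow> (\<forall>B\<in>carrier_mat d d. \<forall>c\<in>labels d. \<forall>r\<in>labels d.
     entry d (X * B) r c = f (\<lambda>r. entry d B r c) r)"

lemma acts_short_mat:
  assumes "a \<in> labels d" "b \<in> labels d" shows "acts (short_op a b t) (short_mat a b t)"
  using assms unfolding acts_def short_mat_def
  by (auto simp: add_mult_distrib_mat[of _ d d] minus_mult_distrib_mat[of _ d d]
      mult_smult_assoc_mat[of _ d d] short_op_def point_def)

lemma acts_long_mat: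
  assumes "a \<in> labels d" shows "acts (long_op a s) (long_mat a s)"
  using assms unfolding acts_def long_mat_def
  by (auto simp: add_mult_distrib_mat[of _ d d] mult_smult_assoc_mat[of _ d d] long_op_def point_def)

lemma acts_zero_mat:
  assumes "0 \<in> labels d" "a \<in> labels d" "a \<noteq> 0" shows "acts (zero_op a t) (zero_mat a t)"
  using assms unfolding acts_def zero_mat_def
  by (auto simp: add_mult_distrib_mat[of _ d d] minus_mult_distrib_mat[of _ d d]
      mult_smult_assoc_mat[of _ d d] zero_op_def point_def)

lemma det_short_mat:
  assumes "a \<in> labels d" "b \<in> labels d" "a \<noteq> 0" "b \<noteq> 0" "a \<noteq> b" "a \<noteq> - b"
  shows "det (short_mat a b t) = 1"
proof -
  \<comment> \<open>The inner row addition changes row \<open>- b\<close>, hence not row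
    \<open>b\<close>, which the outer one uses.\<close>
  have "short_mat a b t = addrow t (label_pos d a) (label_pos d b)
      (addrow (- \<sigma> t) (label_pos d (- b)) (label_pos d (- a)) (1\<^sub>m d))"
    using assms by (intro mat_eq_entryI[of _ d]) (auto simp: short_mat_def)
  then show ?thesis using assms by (simp add: det_addrow[of _ d])
qed

lemma det_long_mat:
  assumes "a \<in> labels d" "a \<noteq> 0" shows "det (long_mat a s) = 1"
proof -
  have "long_mat a s = addrow s (label_pos d (- a)) (label_pos d a) (1\<^sub>m d)"
    using assms by (intro mat_eq_entryI[of _ d]) (auto simp: long_mat_def)
  then show ?thesis using assms by (simp add: det_addrow[of _ d])
qed

lemma det_zero_mat:
  assumes "0 \<in> labels d" "a \<in> labels d" "a \<noteq> 0" shows "det (zero_mat a t) = 1"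
proof -
  \<comment> \<open>Row 0 is changed last, so row \<open>- a\<close> receives the original row
    0.\<close>
  have "zero_mat a t = addrow t (label_pos d 0) (label_pos d a)
      (addrow (- (t * \<sigma> t)) (label_pos d (- a)) (label_pos d a)
        (addrow (- (2 * \<sigma> t)) (label_pos d (- a)) (label_pos d 0) (1\<^sub>m d)))"
    using assms by (intro mat_eq_entryI[of _ d]) (auto simp: zero_mat_def)
  then show ?thesis using assms by (simp add: det_addrow[of _ d])
qed

lemma ops_matrix:
  assumes "f \<in> ops"
  obtains X where "X \<in> elementary_matrices \<sigma> d" "acts f X" "det X = 1"
  using assms
proof cases
  case (short a b t)
  with that show ?thesis by (metis short_mat_elementary acts_short_mat det_short_mat)
next
  case (long a s)
  with that show ?thesis by (metis long_mat_elementary acts_long_mat det_long_mat)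
next
  case (zero a t)
  with that show ?thesis by (metis zero_mat_elementary acts_zero_mat det_zero_mat)
qed

lemma acts_comp:
  assumes "f \<in> ops" "acts f X" "acts g Y" "X \<in> carrier_mat d d" "Y \<in> carrier_mat d d"
  shows "acts (f \<circ> g) (X * Y)"
  unfolding acts_def
proof (intro ballI)
  fix B :: "'a mat" and c r assume B: "B \<in> carrier_mat d d" and c: "c \<in> labels d" and r: "r \<in> labels d"
  have YB: "Y * B \<in> carrier_mat d d" using assms(5) B by simp
  have "entry d (X * Y * B) r c = f (\<lambda>r. entry d (Y * B) r c) r"
    unfolding assoc_mult_mat[OF assms(4,5) B] using assms(2) YB c r unfolding acts_def by blast
  also have "\<dots> = f (g (\<lambda>r. entry d B r c)) r"
    \<comment> \<open>The column of \<open>Y * B\<close> is known only at labels;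
      \<open>ops_cong\<close> shows that this suffices for \<open>f\<close>.\<close>
    using assms(3) B c unfolding acts_def by (intro ops_cong[OF assms(1) _ r]) blast
  finally show "entry d (X * Y * B) r c = (f \<circ> g) (\<lambda>r. entry d B r c) r" unfolding comp_apply .
qed

lemma acts_id: "acts id X \<Longrightarrow> X \<in> carrier_mat d d \<Longrightarrow> X = 1\<^sub>m d"
  unfolding acts_def by (intro mat_eq_entryI[of _ d]) (metis one_carrier_mat right_mult_one_mat id_apply)+

text \<open>Inverse operations are realised by elementary matrices too; listed in reverse order they
  form \<open>Ys\<close>, which later carries the diagonal matrix back to the given one.\<close>

lemma op_words_matrix:
  assumes "f \<in> op_words"
  shows "\<exists>Xs Ys. set Xs \<subseteq> elementary_matrices \<sigma> d \<and> set Ys \<subseteq> elementary_matrices \<sigma> d \<and>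
    acts f (mat_list_prod d Xs) \<and> mat_list_prod d Ys * mat_list_prod d Xs = 1\<^sub>m d \<and>
    det (mat_list_prod d Xs) = 1"
  using assms
proof induction
  case Nil
  show ?case by (intro exI[of _ "[]"]) (auto simp: acts_def)
next
  case (Cons f g)
  then obtain Xs Ys where IH: "set Xs \<subseteq> elementary_matrices \<sigma> d" "set Ys \<subseteq> elementary_matrices \<sigma> d"
    "acts g (mat_list_prod d Xs)" "mat_list_prod d Ys * mat_list_prod d Xs = 1\<^sub>m d"
    "det (mat_list_prod d Xs) = 1" by blast
  obtain X where X: "X \<in> elementary_matrices \<sigma> d" "acts f X" "det X = 1"
    using ops_matrix[OF Cons(1)] .
  obtain f' where f': "f' \<in> ops" "f' \<circ> f = id" using ops_inverse[OF Cons(1)] .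
  obtain Y where Y: "Y \<in> elementary_matrices \<sigma> d" "acts f' Y" "det Y = 1"
    using ops_matrix[OF f'(1)] .
  have carr: "X \<in> carrier_mat d d" "Y \<in> carrier_mat d d"
    "set Xs \<subseteq> carrier_mat d d" "set Ys \<subseteq> carrier_mat d d"
    using X(1) Y(1) IH(1,2) elementary_matrices_carrier by blast+
  define P where "P = mat_list_prod d Xs"
  define Q where "Q = mat_list_prod d Ys"
  have PQ: "P \<in> carrier_mat d d" "Q \<in> carrier_mat d d" using carr by (auto simp: P_def Q_def)
  \<comment> \<open>\<open>Y * X\<close> acts as \<open>f' \<circ> f = id\<close>, and a matrix
    acting as the identity is the identity by \<open>acts_id\<close>.\<close>
  have YX: "Y * X = 1\<^sub>m d"
    using acts_comp[OF f'(1) Y(2) X(2)] f'(2) carr by (intro acts_id) auto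
  have "Q * Y * (X * P) = Q * (Y * X * P)"
    using PQ carr by (simp add: assoc_mult_mat[of _ d d _ d _ d])
  also have "\<dots> = 1\<^sub>m d" using IH(4) PQ by (simp add: YX P_def Q_def)
  finally have "mat_list_prod d (Ys @ [Y]) * mat_list_prod d (X # Xs) = 1\<^sub>m d"
    using carr by (simp add: mat_list_prod_snoc P_def Q_def)
  moreover have "det (mat_list_prod d (X # Xs)) = 1"
    using X IH(5) carr PQ by (simp add: det_mult[of _ d] P_def)
  moreover have "acts (f \<circ> g) (mat_list_prod d (X # Xs))"
    using acts_comp[OF Cons(1) X(2) IH(3)] carr by simp
  moreover have "set (X # Xs) \<subseteq> elementary_matrices \<sigma> d"
    "set (Ys @ [Y]) \<subseteq> elementary_matrices \<sigma> d"
    using X(1) Y(1) IH(1,2) by auto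
  ultimately show ?case by - (rule exI[of _ "X # Xs"], rule exI[of _ "Ys @ [Y]"], intro conjI)
qed

lemma isometric_entry:
  assumes "A \<in> unitary_group \<sigma> d" shows "isometric (\<lambda>c r. entry d A r c)"
  unfolding isometric_def
proof (intro ballI)
  fix c c' assume c: "c \<in> labels d" "c' \<in> labels d"
  define A' where "A' = transpose_mat (map_mat \<sigma> A)"
  have A: "A \<in> carrier_mat d d" "A' \<in> carrier_mat d d" and eq: "A' * form_mat d * A = form_mat d"
    using assms by (auto simp: unitary_group_def A'_def)
  have A'_entry: "entry d A' c k = \<sigma> (entry d A k c)" if "k \<in> labels d" for k
    using that c A by (simp add: A'_def entry_def)
  have inner: "entry d (A' * form_mat d) c k = weight k * \<sigma> (entry d A (- k) c)"
    if k: "k \<in> labels d" for k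
  proof -
    have "entry d (A' * form_mat d) c k
        = (\<Sum>m\<in>labels d. if m = - k then weight k * \<sigma> (entry d A (- k) c) else 0)"
      using k c A by (subst entry_mult)
        (auto intro!: sum.cong simp: A'_entry entry_form_mat weight_def)
    then show ?thesis using k finite_labels by simp
  qed
  have "entry d (form_mat d) c c' = (\<Sum>k\<in>labels d. weight k * \<sigma> (entry d A (- k) c) * entry d A k c')"
    using c A by (subst eq[symmetric], subst entry_mult[of _ d]) (auto simp: inner)
  also have "\<dots> = form (\<lambda>r. entry d A r c) (\<lambda>r. entry d A r c')"
    unfolding form_def
    \<comment> \<open>Replacing \<open>k\<close> by \<open>- k\<close> moves the sign from the first
      argument to the second.\<close>
    by (rule sum.reindex_bij_witness[of _ uminus uminus]) auto
  finally show "form (\<lambda>r. entry d A r c) (\<lambda>r. entry d A r c') = (if c' = - c then weight c else 0)"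
    unfolding entry_form_mat[OF c] weight_def by simp
qed

lemma elementary_transforms_mat_list_prod:
  assumes "set Xs \<subseteq> elementary_matrices \<sigma> d" "A \<in> carrier_mat d d"
  shows "elementary_transforms \<sigma> d A (mat_list_prod d Xs * A)"
  using assms(1)
proof (induction Xs)
  case Nil
  then show ?case using assms(2) by (simp add: elementary_transforms.refl)
next
  case (Cons X Xs)
  then have "X \<in> carrier_mat d d" "mat_list_prod d Xs \<in> carrier_mat d d"
    using elementary_matrices_carrier by (auto intro!: mat_list_prod_carrier)
  then show ?case
    using Cons elementary_transforms.left[of \<sigma> d A "mat_list_prod d Xs * A" X] assms(2)
    by (simp add: assoc_mult_mat[of _ d d _ d _ d])
qed

end

section \<open>Locale assumptions from the field automorphism, and determinants of the normal
  forms\<close>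

lemma unitary_matricesI:
  assumes "order2_field_automorphism \<sigma>" "odd d \<Longrightarrow> CHAR('a) \<noteq> 2"
  shows "unitary_matrices (\<sigma> :: 'a::field \<Rightarrow> 'a) d"
proof -
  interpret field_isom \<sigma> using assms(1) by (simp add: order2_field_automorphism_def)
  have invol: "\<sigma> (\<sigma> x) = x" for x
    using assms(1) by (auto simp: order2_field_automorphism_def fun_eq_iff)
  obtain x where x: "\<sigma> x \<noteq> x" using assms(1) by (auto simp: order2_field_automorphism_def fun_eq_iff)
  \<comment> \<open>\<open>\<sigma>\<close> exchanges \<open>x\<close> and
    \<open>\<sigma> x\<close>, so their difference is skew, in every characteristic.\<close>
  have "\<sigma> (x - \<sigma> x) = - (x - \<sigma> x)" unfolding hom_minus invol by simp
  moreover have "x - \<sigma> x \<noteq> 0" using x by (metis eq_iff_diff_eq_0)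
  ultimately have skew: "\<exists>s. s \<noteq> 0 \<and> \<sigma> s = - s" by blast
  have "(2::'a) \<noteq> 0" if "odd d"
  proof
    assume "(2::'a) = 0"
    then have "of_nat 2 = (0::'a)" by simp
    \<comment> \<open>The only divisors of 2 are 1, which is no characteristic of a field, and 2,
      which is excluded.\<close>
    then have "CHAR('a) dvd 2" by (simp only: of_nat_eq_0_iff_char_dvd)
    then show False using assms(2)[OF that] CHAR_not_1[where 'a='a]
        two_is_prime_nat prime_nat_iff[of 2] by auto
  qed
  then have "unitary_form_axioms \<sigma> (labels d)"
    using finite_labels invol skew by (intro unitary_form_axioms.intro) (simp_all add: labels_def)
  then show ?thesis
    by (intro unitary_matrices.intro unitary_form.intro field_isom_axioms)
qed

lemma det_mat_diag: "det (mat_diag n f) = (\<Prod>i<n. f i)"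
  by (subst det_upper_triangular[of _ n])
    (auto simp: mat_diag_def prod_list_diag_prod atLeast0LessThan intro!: upper_triangularI)

lemma prod_two_exceptions:
  fixes f :: "nat \<Rightarrow> 'a::comm_monoid_mult"
  assumes "p < n" "q < n" "p \<noteq> q" "\<And>i. i < n \<Longrightarrow> i \<noteq> p \<Longrightarrow> i \<noteq> q \<Longrightarrow> f i = 1"
  shows "(\<Prod>i<n. f i) = f p * f q"
proof -
  have "(\<Prod>i<n. f i) = (\<Prod>i\<in>{p, q}. f i)"
    using assms by (intro prod.mono_neutral_right) auto
  then show ?thesis using assms by simp
qed

lemma det_normal_diag_even:
  assumes "l > 0" shows "det (normal_diag_even \<sigma> l \<mu>) = \<mu> * inverse (\<sigma> \<mu>)"
proof -
  have "int l \<in> labels (2 * l)" "- int l \<in> labels (2 * l)" using assms by (auto simp: labels_def)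
  then show ?thesis
    unfolding normal_diag_even_def Let_def det_mat_diag using assms
    by (subst prod_two_exceptions[of "label_pos (2 * l) (int l)" _ "label_pos (2 * l) (- int l)"]) auto
qed

lemma det_normal_diag_odd:
  assumes "l > 0" shows "det (normal_diag_odd \<sigma> l \<alpha> \<mu>) = \<alpha> * \<mu> * inverse (\<sigma> \<mu>)"
proof -
  let ?p = "label_pos (2 * l + 1)"
  have lab: "int l \<in> labels (2 * l + 1)" "- int l \<in> labels (2 * l + 1)" "0 \<in> labels (2 * l + 1)"
    using assms by (auto simp: labels_def)
  let ?f = "\<lambda>i. if i = ?p 0 then \<alpha> else if i = ?p (int l) then \<mu>
    else if i = ?p (- int l) then inverse (\<sigma> \<mu>) else 1"
  have less: "?p (int l) < 2 * l + 1" "?p (- int l) < 2 * l + 1" "?p 0 < 2 * l + 1"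
    using lab by (simp_all only: label_pos_less)
  have "(\<Prod>i<2 * l + 1. ?f i) = (\<Prod>i\<in>{?p 0, ?p (int l), ?p (- int l)}. ?f i)"
    using less by (intro prod.mono_neutral_right) (auto simp del: label_pos_less)
  then show ?thesis
    unfolding normal_diag_odd_def Let_def det_mat_diag using lab assms
    by (simp add: label_pos_eq_iff mult.assoc)
qed

theorem theoremA:
  fixes \<sigma> :: "'a::field \<Rightarrow> 'a" and d :: nat and A :: "'a mat"
  assumes "order2_field_automorphism \<sigma>"
    and "d \<ge> 4"
    and "odd d \<Longrightarrow> CHAR('a) \<noteq> 2"
    and "A \<in> unitary_group \<sigma> d"
  shows "\<exists>\<Delta>. elementary_transforms \<sigma> d A \<Delta> \<and>
           (\<exists>Xs Ys. set Xs \<subseteq> elementary_matrices \<sigma> d \<and> set Ys \<subseteq> elementary_matrices \<sigma> d \<and>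
              A = mat_list_prod d Xs * \<Delta> * mat_list_prod d Ys) \<and>
           (\<forall>l. d = 2 * l \<longrightarrow>
              (\<exists>\<mu>. \<mu> \<noteq> 0 \<and> \<Delta> = normal_diag_even \<sigma> l \<mu> \<and> \<mu> * inverse (\<sigma> \<mu>) = det A)) \<and>
           (\<forall>l. d = 2 * l + 1 \<longrightarrow>
              (\<exists>\<alpha> \<mu>. \<mu> \<noteq> 0 \<and> \<Delta> = normal_diag_odd \<sigma> l \<alpha> \<mu> \<and>
                 \<alpha> * \<sigma> \<alpha> = 1 \<and> \<alpha> * \<mu> * inverse (\<sigma> \<mu>) = det A))"
proof -
  interpret unitary_matrices \<sigma> d using assms(1,3) by (rule unitary_matricesI)
  define k where "k = d div 2"
  have k: "k > 0" using assms(2) by (simp add: k_def)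
  have A: "A \<in> carrier_mat d d" using assms(4) by (simp add: unitary_group_def)
  have lab: "r \<noteq> 0 \<Longrightarrow> r \<in> labels d \<longleftrightarrow> \<bar>r\<bar> \<le> int k" for r by (simp add: labels_def k_def)
  obtain f \<alpha> \<mu> where f: "f \<in> op_words" and \<mu>: "\<mu> \<noteq> 0" and \<alpha>: "0 \<in> labels d \<Longrightarrow> \<alpha> * \<sigma> \<alpha> = 1"
    and f_entry: "\<And>c r. c \<in> labels d \<Longrightarrow> r \<in> labels d \<Longrightarrow> f (\<lambda>r. entry d A r c) r =
       (if r \<noteq> c then 0 else if c = 0 then \<alpha> else if c = int k then \<mu>
        else if c = - int k then inverse (\<sigma> \<mu>) else 1)"
    using reduce[OF isometric_entry[OF assms(4)] lab k] by blast
  obtain Xs Ys where Xs: "set Xs \<subseteq> elementary_matrices \<sigma> d" and Ys: "set Ys \<subseteq> elementary_matrices \<sigma> d"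
    and act: "acts f (mat_list_prod d Xs)"
    and inv: "mat_list_prod d Ys * mat_list_prod d Xs = 1\<^sub>m d"
    and det1: "det (mat_list_prod d Xs) = 1"
    using op_words_matrix[OF f] by blast
  have carr: "mat_list_prod d Xs \<in> carrier_mat d d" "mat_list_prod d Ys \<in> carrier_mat d d"
    using Xs Ys elementary_matrices_carrier by (blast intro!: mat_list_prod_carrier)+
  define \<Delta> where "\<Delta> = mat_list_prod d Xs * A"
  have \<Delta>: "\<Delta> \<in> carrier_mat d d" using carr A by (simp add: \<Delta>_def)
  \<comment> \<open>The row operations have determinant 1, so the determinant of the normal form is
    that of \<open>A\<close>.\<close>
  have det: "det \<Delta> = det A" using carr A det1 by (simp add: \<Delta>_def det_mult[of _ d])
  have \<Delta>_entry: "entry d \<Delta> r c = (if r \<noteq> c then 0 else if c = 0 then \<alpha> else if c = int k then \<mu>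
        else if c = - int k then inverse (\<sigma> \<mu>) else 1)" if "r \<in> labels d" "c \<in> labels d" for r c
  proof -
    have "entry d \<Delta> r c = f (\<lambda>r. entry d A r c) r"
      using act A that unfolding acts_def \<Delta>_def by blast
    then show ?thesis unfolding f_entry[OF that(2,1)] .
  qed
  have even: "\<Delta> = normal_diag_even \<sigma> l \<mu>" if d: "d = 2 * l" for l
  proof -
    have [simp]: "k = l" using d by (simp add: k_def)
    have "int l \<in> labels d" "- int l \<in> labels d" "0 \<notin> labels d" using k d by (auto simp: labels_def)
    then show ?thesis
      unfolding normal_diag_even_def Let_def d[symmetric]
      by (intro mat_diag_entryI \<Delta>) (auto simp: \<Delta>_entry)
  qed
  have odd: "\<Delta> = normal_diag_odd \<sigma> l \<alpha> \<mu>" if d: "d = 2 * l + 1" for l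
  proof -
    have [simp]: "k = l" using d by (simp add: k_def)
    have "int l \<in> labels d" "- int l \<in> labels d" "0 \<in> labels d" using k d by (auto simp: labels_def)
    then show ?thesis
      unfolding normal_diag_odd_def Let_def d[symmetric] using k
      by (intro mat_diag_entryI \<Delta>) (auto simp: \<Delta>_entry)
  qed
  have "mat_list_prod d Ys * \<Delta> = mat_list_prod d Ys * mat_list_prod d Xs * A"
    unfolding \<Delta>_def using carr A by (simp add: assoc_mult_mat[of _ d d _ d _ d])
  then have "A = mat_list_prod d Ys * \<Delta>" using inv A by simp
  \<comment> \<open>Row operations alone sufficed, so the list of right factors is empty.\<close>
  then have fact: "A = mat_list_prod d Ys * \<Delta> * mat_list_prod d []"
    using carr \<Delta> by simp
  have factors: "\<exists>Xs Ys. set Xs \<subseteq> elementary_matrices \<sigma> d \<and> set Ys \<subseteq> elementary_matrices \<sigma> d \<and>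
      A = mat_list_prod d Xs * \<Delta> * mat_list_prod d Ys"
    by (rule exI[of _ Ys], rule exI[of _ "[]"], intro conjI Ys fact) simp
  have transforms: "elementary_transforms \<sigma> d A \<Delta>"
    unfolding \<Delta>_def by (rule elementary_transforms_mat_list_prod[OF Xs A])
  have even_case: "\<exists>\<mu>. \<mu> \<noteq> 0 \<and> \<Delta> = normal_diag_even \<sigma> l \<mu> \<and> \<mu> * inverse (\<sigma> \<mu>) = det A"
    if "d = 2 * l" for l
  proof -
    have "l > 0" using that assms(2) by simp
    then have "\<mu> * inverse (\<sigma> \<mu>) = det A"
      using det unfolding even[OF that] by (simp only: det_normal_diag_even)
    then show ?thesis using \<mu> even[OF that] by blast
  qed
  have odd_case: "\<exists>\<alpha> \<mu>. \<mu> \<noteq> 0 \<and> \<Delta> = normal_diag_odd \<sigma> l \<alpha> \<mu> \<and>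
                 \<alpha> * \<sigma> \<alpha> = 1 \<and> \<alpha> * \<mu> * inverse (\<sigma> \<mu>) = det A" if "d = 2 * l + 1" for l
  proof -
    have "l > 0" using that assms(2) by simp
    then have "\<alpha> * \<mu> * inverse (\<sigma> \<mu>) = det A"
      using det unfolding odd[OF that] by (simp only: det_normal_diag_odd)
    moreover have "0 \<in> labels d" using that by (simp add: labels_def)
    ultimately show ?thesis using \<mu> \<alpha> odd[OF that] by blast
  qed
  show ?thesis
    by (rule exI[of _ \<Delta>], intro conjI allI impI transforms factors even_case odd_case)
qed

end
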